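(* For all $A,B\in\mathrm{evZ}$, all $\boldsymbol{\ell},\boldsymbol{r}\in\mathbb{N}_0^2$ with $\boldsymbol{\ell}\leq\mathsf{size}(A)\leq\boldsymbol{r}$ and all matrix compositions $\mathbf{a}\in\mathrm{Cmp}$, $$\langle\mathsf{SS}_{\boldsymbol{\ell};\boldsymbol{r}}(A\oslash B),\mathbf{a}\rangle=\sum_{\mathrm{diag}(\mathbf{b},\mathbf{c})=\mathbf{a}}\langle\mathsf{SS}_{\boldsymbol{\ell};\mathsf{size}(A)}(A\oslash B),\mathbf{b}\rangle\,\langle\mathsf{SS}_{\mathsf{size}(A);\boldsymbol{r}}(A\oslash B),\mathbf{c}\rangle,$$ where the sum is over all pairs $(\mathbf{b},\mathbf{c})\in\mathrm{Cmp}^2$ with $\mathrm{diag}(\mathbf{b},\mathbf{c})=\mathbf{a}$. Equivalently, for all $A,B\in\mathrm{evZ}$, $$\mathsf{SS}(A\oslash B)=\mathsf{SS}(A)\cdot\mathsf{SS}(B).$$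
   Context: $\mathbb{K}$ is an integral domain, $\mathbb{N}=\{1,2,\ldots\}$, $\mathbb{N}_0=\{0\}\cup\mathbb{N}$, $d\in\mathbb{N}$ is fixed; tuples are compared in the product order. $(\mathfrak{M}_d,\star,\varepsilon)$ is the free commutative monoid generated by $d$ letters $\mathbf{1},\ldots,\mathbf{d}$. A non-empty matrix composition is a matrix $\mathbf{a}\in\mathfrak{M}_d^{m\times n}$ ($m,n\geq1$) such that no row and no column consists only of entries $\varepsilon$. $\mathrm{Cmp}$ is the set of all these matrices together with an additional element $\mathsf{e}$, the empty composition. $\mathrm{diag}(\mathbf{a},\mathbf{b})$ is the block diagonal matrix with blocks $\mathbf{a}$ (upper left), $\mathbf{b}$ (lower right) and all other entries $\varepsilon$ (blocks need not be square), and $\mathrm{diag}(\mathsf{e},\mathbf{a})=\mathrm{diag}(\mathbf{a},\mathsf{e})=\mathbf{a}$. $\mathrm{evZ}$ is the $\mathbb{K}$-module of functions $Z:\mathbb{N}^2\to\mathbb{K}^d$ of finite support; $\mathsf{size}(Z)=(\mathsf{rows}(Z),\mathsf{cols}(Z))$ is the least $\boldsymbol{n}\in\mathbb{N}^2$ such that $Z_{\boldsymbol{i}}\neq0$ implies $\boldsymbol{i}\leq\boldsymbol{n}$. For $(a,k)\in\{1,2\}\times\mathbb{N}$, $\mathsf{Zero}_{a,k}:\mathrm{evZ}\to\mathrm{evZ}$ inserts a zero row ($a=1$) or column ($a=2$) at position $k$: $(\mathsf{Zero}_{a,k}X)_{\boldsymbol{i}}$ equals $X_{\boldsymbol{i}}$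 if $\boldsymbol{i}_a<k$, $0$ if $\boldsymbol{i}_a=k$, and $X_{\boldsymbol{i}-e_a}$ if $\boldsymbol{i}_a>k$. Diagonal concatenation is $A\oslash B=A+\mathsf{Zero}_{1,1}^{\mathsf{rows}(A)}\circ\mathsf{Zero}_{2,1}^{\mathsf{cols}(A)}(B)$ (exponents denote iteration). For $z\in\mathbb{K}^d$, $\lambda\mapsto z^{(\lambda)}$ is the monoid homomorphism from $\mathfrak{M}_d$ to the multiplicative monoid of $\mathbb{K}$ with $z^{(\mathbf{j})}=z_j$. For $Z:\mathbb{N}^2\to\mathbb{K}^d$ and $\boldsymbol{\ell},\boldsymbol{r}\in\mathbb{N}_0^2$, $\mathsf{SS}_{\boldsymbol{\ell};\boldsymbol{r}}(Z)$ is the function $\mathrm{Cmp}\to\mathbb{K}$ with $\langle\mathsf{SS}_{\boldsymbol{\ell};\boldsymbol{r}}(Z),\mathsf{e}\rangle=1$ and, for $\mathbf{a}$ of size $m\times n$, $$\langle\mathsf{SS}_{\boldsymbol{\ell};\boldsymbol{r}}(Z),\mathbf{a}\rangle=\sum_{\substack{\boldsymbol{\ell}_1<\iota_1<\cdots<\iota_m\leq\boldsymbol{r}_1\\ \boldsymbol{\ell}_2<\kappa_1<\cdots<\kappa_n\leq\boldsymbol{r}_2}}\ \prod_{s=1}^{m}\prod_{t=1}^{n}Z_{\iota_s,\kappa_t}^{(\mathbf{a}_{s,t})}.$$ For $Z\in\mathrm{evZ}$, $\mathsf{SS}(Z)=\lim_{\boldsymbol{r}\to\infty}\mathsf{SS}_{(0,0);\boldsymbol{r}}(Z)$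 (i.e. no upper bounds). Functions $F,G:\mathrm{Cmp}\to\mathbb{K}$ are multiplied by $\langle F\cdot G,\mathbf{a}\rangle=\sum_{\mathrm{diag}(\mathbf{b},\mathbf{c})=\mathbf{a}}\langle F,\mathbf{b}\rangle\langle G,\mathbf{c}\rangle$. *)

theory Defs
  imports
    "HOL-Analysis.Finite_Cartesian_Product"
    "HOL-Library.Product_Order"
    "HOL-Library.Multiset"
    "HOL-Library.FuncSet"
    "Jordan_Normal_Form.Matrix"
begin

text \<open>
  The free commutative monoid on the letters \<open>'d\<close> (a nonempty finite type, \<open>d = CARD('d)\<close>) is
  \<open>'d multiset\<close>, with \<open>{#}\<close> as \<open>\<epsilon>\<close> and \<open>+\<close> as \<open>\<star>\<close>.  Matrix entries are indexed from 0,
  as always for \<open>mat\<close>.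
\<close>

datatype 'd comp = EmptyComp | MatComp "'d multiset mat"

definition Cmp :: "'d comp set" where
  "Cmp = insert EmptyComp (MatComp ` {a. dim_row a \<ge> 1 \<and> dim_col a \<ge> 1 \<and>
      (\<forall>s<dim_row a. \<exists>t<dim_col a. a $$ (s, t) \<noteq> {#}) \<and>
      (\<forall>t<dim_col a. \<exists>s<dim_row a. a $$ (s, t) \<noteq> {#})})"

fun diag :: "'d comp \<Rightarrow> 'd comp \<Rightarrow> 'd comp" where
  "diag EmptyComp b = b"
| "diag a EmptyComp = a"
| "diag (MatComp a) (MatComp b) = MatComp (four_block_mat a
      (mat (dim_row a) (dim_col b) (\<lambda>_. {#})) (mat (dim_row b) (dim_col a) (\<lambda>_. {#})) b)"

text \<open>
  Functions on pairs of positive integers are modelled as functions on \<open>nat \<times> nat\<close>; indices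
  with a component 0 lie outside the mathematical domain, and members of \<open>evZ\<close> vanish there, so
  that they correspond one-to-one to the finitely supported functions on pairs of positive
  integers.  The order on \<open>nat \<times> nat\<close> is the product order.
\<close>

definition evZ :: "(nat \<times> nat \<Rightarrow> 'k::idom ^ 'd) set" where
  "evZ = {Z. finite {i. Z i \<noteq> 0} \<and> (\<forall>i. Z i \<noteq> 0 \<longrightarrow> (1, 1) \<le> i)}"

definition size_ev :: "(nat \<times> nat \<Rightarrow> 'k::idom ^ 'd) \<Rightarrow> nat \<times> nat" where
  "size_ev Z = (LEAST n. (1, 1) \<le> n \<and> (\<forall>i. Z i \<noteq> 0 \<longrightarrow> i \<le> n))"

abbreviation rows_ev :: "(nat \<times> nat \<Rightarrow> 'k::idom ^ 'd) \<Rightarrow> nat" where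
  "rows_ev Z \<equiv> fst (size_ev Z)"

abbreviation cols_ev :: "(nat \<times> nat \<Rightarrow> 'k::idom ^ 'd) \<Rightarrow> nat" where
  "cols_ev Z \<equiv> snd (size_ev Z)"

text \<open>The axis argument is 1 (rows) or 2 (columns); positions \<open>k\<close> start at 1.\<close>

definition coord :: "nat \<Rightarrow> nat \<times> nat \<Rightarrow> nat" where
  "coord a i = (if a = 1 then fst i else snd i)"

definition unit_index :: "nat \<Rightarrow> nat \<times> nat" where
  "unit_index a = (if a = 1 then (1, 0) else (0, 1))"

definition Zero_ins ::
    "nat \<Rightarrow> nat \<Rightarrow> (nat \<times> nat \<Rightarrow> 'k::idom ^ 'd) \<Rightarrow> (nat \<times> nat \<Rightarrow> 'k ^ 'd)" where
  "Zero_ins a k X = (\<lambda>i. if coord a i < k then X i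
                         else if coord a i = k then 0
                         else X (i - unit_index a))"

definition diag_concat ::
    "(nat \<times> nat \<Rightarrow> 'k::idom ^ 'd) \<Rightarrow> (nat \<times> nat \<Rightarrow> 'k ^ 'd) \<Rightarrow> (nat \<times> nat \<Rightarrow> 'k ^ 'd)"
    (infixl \<open>\<oslash>\<close> 65) where
  "A \<oslash> B = (\<lambda>i. A i + ((Zero_ins 1 1 ^^ rows_ev A) ((Zero_ins 2 1 ^^ cols_ev A) B)) i)"

definition mon_eval :: "'k::idom ^ 'd \<Rightarrow> 'd multiset \<Rightarrow> 'k" where
  "mon_eval z u = (\<Prod>j\<in>#u. vec_nth z j)"

lemma mon_eval_hom:
  "mon_eval z {#} = 1" "mon_eval z (u + v) = mon_eval z u * mon_eval z v"
  "mon_eval z {#j#} = vec_nth z j"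
  by (simp_all add: mon_eval_def)

text \<open>The sequences \<open>l < \<iota> 0 < \<dots> < \<iota> (m - 1) \<le> r\<close>, extensional outside \<open>{..<m}\<close>.\<close>

definition incr_seqs :: "nat \<Rightarrow> nat \<Rightarrow> nat \<Rightarrow> (nat \<Rightarrow> nat) set" where
  "incr_seqs m l r = {\<iota> \<in> {..<m} \<rightarrow>\<^sub>E {l<..r}. strict_mono_on {..<m} \<iota>}"

fun SS_between ::
    "nat \<times> nat \<Rightarrow> nat \<times> nat \<Rightarrow> (nat \<times> nat \<Rightarrow> 'k::idom ^ 'd) \<Rightarrow> 'd comp \<Rightarrow> 'k" where
  "SS_between l r Z EmptyComp = 1"
| "SS_between l r Z (MatComp a) =
     (\<Sum>(\<iota>, \<kappa>) \<in> incr_seqs (dim_row a) (fst l) (fst r) \<times> incr_seqs (dim_col a) (snd l) (snd r).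
        \<Prod>s<dim_row a. \<Prod>t<dim_col a. mon_eval (Z (\<iota> s, \<kappa> t)) (a $$ (s, t)))"

text \<open>
  The limit \<open>r \<rightarrow> \<infinity>\<close> is taken coefficientwise with respect to the discrete topology on \<open>'k\<close>:
  it is the value attained for all sufficiently large \<open>r\<close>, which exists for \<open>Z \<in> evZ\<close> and
  \<open>a \<in> Cmp\<close> by \<open>SS_eqI\<close> and \<open>SS_between_stable\<close> below.
\<close>

definition SS :: "(nat \<times> nat \<Rightarrow> 'k::idom ^ 'd) \<Rightarrow> 'd comp \<Rightarrow> 'k" where
  "SS Z a = (THE c. \<exists>r0. \<forall>r\<ge>r0. SS_between (0, 0) r Z a = c)"

definition comp_mult :: "('d comp \<Rightarrow> 'k::idom) \<Rightarrow> ('d comp \<Rightarrow> 'k) \<Rightarrow> 'd comp \<Rightarrow> 'k" where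
  "comp_mult F G a = (\<Sum>(b, c) \<in> {(b, c) \<in> Cmp \<times> Cmp. diag b c = a}. F b * G c)"

lemma SS_eqI:
  assumes "\<And>r. r \<ge> r0 \<Longrightarrow> SS_between (0, 0) r Z a = c"
  shows "SS Z a = c"
  unfolding SS_def
proof (rule the_equality)
  show "\<exists>r0. \<forall>r\<ge>r0. SS_between (0, 0) r Z a = c" using assms by blast
next
  fix c' assume "\<exists>r0. \<forall>r\<ge>r0. SS_between (0, 0) r Z a = c'"
  then obtain r1 where "\<forall>r\<ge>r1. SS_between (0, 0) r Z a = c'" by blast
  with assms[of "sup r0 r1"] show "c' = c" by (metis sup.cobounded1 sup.cobounded2)
qed

lemma size_ev:
  assumes "Z \<in> evZ"
  shows "(1, 1) \<le> size_ev Z" "\<And>i. Z i \<noteq> 0 \<Longrightarrow> i \<le> size_ev Z"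
    "\<And>n. (1, 1) \<le> n \<Longrightarrow> (\<And>i. Z i \<noteq> 0 \<Longrightarrow> i \<le> n) \<Longrightarrow> size_ev Z \<le> n"
proof -
  let ?P = "\<lambda>n. (1, 1) \<le> n \<and> (\<forall>i. Z i \<noteq> 0 \<longrightarrow> i \<le> n)"
  let ?S = "{i. Z i \<noteq> 0}"
  let ?n = "(Max (insert 1 (fst ` ?S)), Max (insert 1 (snd ` ?S)))"
  have fin: "finite ?S" using assms by (simp add: evZ_def)
  have P: "?P ?n" using fin by (auto simp: less_eq_prod_def intro!: Max_ge)
  have le: "?n \<le> n" if "?P n" for n
    using that fin by (auto simp: less_eq_prod_def)
  have "size_ev Z = ?n" unfolding size_ev_def
    by (rule Least_equality[where P = ?P and x = ?n]) (use P le in blast)+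
  then show "(1, 1) \<le> size_ev Z" "\<And>i. Z i \<noteq> 0 \<Longrightarrow> i \<le> size_ev Z"
    "\<And>n. (1, 1) \<le> n \<Longrightarrow> (\<And>i. Z i \<noteq> 0 \<Longrightarrow> i \<le> n) \<Longrightarrow> size_ev Z \<le> n"
    using P le by auto
qed

lemma mon_eval_zero: "u \<noteq> {#} \<Longrightarrow> mon_eval 0 u = 0"
  by (cases u) (auto simp: mon_eval_def)

lemma SS_between_stable:
  assumes Z: "Z \<in> evZ" and a: "a \<in> Cmp" and r: "size_ev Z \<le> r"
  shows "SS_between l r Z a = SS_between l (size_ev Z) Z a"
proof (cases a)
  case (MatComp M)
  let ?I = "\<lambda>r. incr_seqs (dim_row M) (fst l) (fst r) \<times> incr_seqs (dim_col M) (snd l) (snd r)"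
  have M: "\<forall>s<dim_row M. \<exists>t<dim_col M. M $$ (s, t) \<noteq> {#}"
    "\<forall>t<dim_col M. \<exists>s<dim_row M. M $$ (s, t) \<noteq> {#}"
    using a MatComp by (auto simp: Cmp_def)
  have fin: "finite (incr_seqs m p q)" for m p q
    unfolding incr_seqs_def by (rule finite_subset[OF _ finite_PiE[of "{..<m}" "\<lambda>_. {p<..q}"]]) auto
  have sub: "?I (size_ev Z) \<subseteq> ?I r"
    using r by (auto simp: incr_seqs_def less_eq_prod_def PiE_def Pi_def intro: le_trans)
  have zero: "(\<Prod>s<dim_row M. \<Prod>t<dim_col M. mon_eval (Z (f s, g t)) (M $$ (s, t))) = 0"
    if fg: "(f, g) \<in> ?I r - ?I (size_ev Z)" for f g
  proof -
    have "(\<exists>s<dim_row M. fst (size_ev Z) < f s) \<or> (\<exists>t<dim_col M. snd (size_ev Z) < g t)"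
      using fg by (fastforce simp: incr_seqs_def PiE_def Pi_def not_le)
    then have "\<exists>s<dim_row M. \<exists>t<dim_col M. M $$ (s, t) \<noteq> {#} \<and> \<not> (f s, g t) \<le> size_ev Z"
      using M unfolding less_eq_prod_def by (metis fst_conv snd_conv not_le)
    then obtain s t where st: "s < dim_row M" "t < dim_col M" "M $$ (s, t) \<noteq> {#}"
      "Z (f s, g t) = 0" using size_ev(2)[OF Z] by blast
    have "(\<Prod>t<dim_col M. mon_eval (Z (f s, g t)) (M $$ (s, t))) = 0"
      using st mon_eval_zero[OF st(3)] by (intro prod_zero bexI[of _ t]) auto
    with st(1) show ?thesis by (auto intro!: prod_zero)
  qed
  have "sum (\<lambda>(f, g). \<Prod>s<dim_row M. \<Prod>t<dim_col M. mon_eval (Z (f s, g t)) (M $$ (s, t))) (?I r) =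
        sum (\<lambda>(f, g). \<Prod>s<dim_row M. \<Prod>t<dim_col M. mon_eval (Z (f s, g t)) (M $$ (s, t))) (?I (size_ev Z))"
  proof (rule sum.mono_neutral_right)
    show "finite (?I r)" using fin by blast
    show "\<forall>p\<in>?I r - ?I (size_ev Z).
        (case p of (f, g) \<Rightarrow> \<Prod>s<dim_row M. \<Prod>t<dim_col M. mon_eval (Z (f s, g t)) (M $$ (s, t))) = 0"
    proof
      fix p assume "p \<in> ?I r - ?I (size_ev Z)"
      then show "(case p of (f, g) \<Rightarrow> \<Prod>s<dim_row M. \<Prod>t<dim_col M. mon_eval (Z (f s, g t)) (M $$ (s, t))) = 0"
        by (cases p) (simp only: prod.case zero)
    qed
  qed (rule sub)
  then show ?thesis using MatComp by simp
qed simp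

end

theory Submission
  imports Defs
begin

text \<open>
  With \<open>N = size_ev A\<close>, the array \<open>Z = A \<oslash> B\<close> vanishes at every position that lies in the first
  \<open>fst N\<close> rows or in the first \<open>snd N\<close> columns but not in both: its nonzero entries sit in two
  diagonal boxes.  Take a summand of \<open>SS_between l r Z\<close> at a matrix \<open>M\<close>, that is, increasing row
  and column indices, and let the first \<open>p\<close> row indices and
  the first \<open>q\<close> column indices be the ones that do not exceed \<open>N\<close>.  An entry of \<open>M\<close> outside the
  two diagonal blocks of the cut \<open>(p, q)\<close> is evaluated at a zero of \<open>Z\<close>, which annihilates the
  summand unless the entry is \<open>\<epsilon>\<close>.  So only the cuts survive for which \<open>M\<close> is block diagonal, and
  for these the summand is a product of a summand for each block (\<open>weight_join_seq\<close>).  As a pair of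
  increasing sequences, one up to \<open>N\<close> and one beyond \<open>N\<close>, is the same as one increasing sequence
  with a cut (\<open>sum_incr_seqs_split\<close>), the sum for \<open>M\<close> becomes a sum over such cuts
  (\<open>SS_mat_split\<close>).

  The cuts at which \<open>M\<close> is block diagonal correspond to the factorizations \<open>diag b c = a\<close> of the
  composition \<open>a\<close> given by \<open>M\<close> (\<open>sum_diag_factorizations\<close>).  The cuts \<open>(0, 0)\<close> and
  \<open>(dim_row M, dim_col M)\<close> belong to the factorizations with an empty factor.  At every other cut on
  the boundary, such as one with \<open>p = 0 < q\<close>, the matrix \<open>M\<close> is never block diagonal, because it
  has no row or column of \<open>\<epsilon>\<close>'s.  To treat the two corner cuts like the others, the empty composition
  is identified with the \<open>0 \<times> 0\<close> matrix.

  For the multiplicativity of \<open>SS\<close>, take \<open>l = 0\<close> and \<open>r\<close> large: on the box up to \<open>N\<close> the array \<open>Z\<close> is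
  \<open>A\<close>, and beyond \<open>N\<close> it is a translate of \<open>B\<close>.
\<close>

section \<open>Cutting increasing sequences\<close>

definition join_seq :: "nat \<Rightarrow> nat \<Rightarrow> (nat \<Rightarrow> nat) \<Rightarrow> (nat \<Rightarrow> nat) \<Rightarrow> nat \<Rightarrow> nat" where
  "join_seq m p f g = (\<lambda>s. if s < p then f s else if s < m then g (s - p) else undefined)"

lemma incr_seqs_iff:
  "f \<in> incr_seqs m l r \<longleftrightarrow>
     (\<forall>s<m. l < f s \<and> f s \<le> r) \<and> (\<forall>s\<ge>m. f s = undefined) \<and> (\<forall>s t. s < t \<and> t < m \<longrightarrow> f s < f t)"
  by (auto simp: incr_seqs_def PiE_iff strict_mono_on_def extensional_def)

lemma incr_seqs_range:
  "f \<in> incr_seqs m l r \<Longrightarrow> s < m \<Longrightarrow> l < f s" "f \<in> incr_seqs m l r \<Longrightarrow> s < m \<Longrightarrow> f s \<le> r"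
  by (auto simp: incr_seqs_iff)

lemma finite_incr_seqs: "finite (incr_seqs m l r)"
  unfolding incr_seqs_def
  by (rule finite_subset[OF _ finite_PiE[of "{..<m}" "\<lambda>_. {l<..r}"]]) auto

lemma join_seq_in_incr_seqs:
  assumes "l \<le> N" "N \<le> r" "p \<le> m" "f \<in> incr_seqs p l N" "g \<in> incr_seqs (m - p) N r"
  shows "join_seq m p f g \<in> incr_seqs m l r"
proof -
  have f: "l < f s" "f s \<le> N" if "s < p" for s
    using incr_seqs_range[OF assms(4) that] by auto
  have g: "N < g s" "g s \<le> r" if "s < m - p" for s
    using incr_seqs_range[OF assms(5) that] by auto
  have "join_seq m p f g s < join_seq m p f g t" if st: "s < t" "t < m" for s t
  proof -
    consider "t < p" | "s < p" "p \<le> t" | "p \<le> s" by linarith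
    then show ?thesis
    proof cases
      case 1
      then show ?thesis using st assms(4) by (auto simp: join_seq_def incr_seqs_iff)
    next
      case 2
      then have "t - p < m - p" using st by (intro diff_less_mono)
      then have "f s < g (t - p)" using f(2)[OF 2(1)] g(1)[of "t - p"] by simp
      then show ?thesis using 2 st by (auto simp: join_seq_def)
    next
      case 3
      then have "s - p < t - p" "t - p < m - p" using st by auto
      then have "g (s - p) < g (t - p)" using assms(5) unfolding incr_seqs_iff by blast
      then show ?thesis using 3 st by (auto simp: join_seq_def)
    qed
  qed
  moreover have "l < join_seq m p f g s" "join_seq m p f g s \<le> r" if "s < m" for s
    using f[of s] g[of "s - p"] assms(1,2) diff_less_mono[OF that, of p] that
    by (auto simp: join_seq_def not_less)
  ultimately show ?thesis
    using assms(3) by (auto simp: incr_seqs_iff join_seq_def)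
qed

text \<open>For increasing \<open>h\<close> this is the number of \<open>s < m\<close> with \<open>h s \<le> N\<close>.\<close>

definition cut_point :: "nat \<Rightarrow> nat \<Rightarrow> (nat \<Rightarrow> nat) \<Rightarrow> nat" where
  "cut_point m N h = (LEAST p. p = m \<or> N < h p)"

lemma cut_point_eqI:
  assumes "p \<le> m" "\<And>s. s < p \<Longrightarrow> h s \<le> N" "p < m \<Longrightarrow> N < h p"
  shows "cut_point m N h = p"
  unfolding cut_point_def
proof (rule Least_equality)
  show "p = m \<or> N < h p" using assms(1,3) by (cases "p = m") auto
  show "p \<le> p'" if "p' = m \<or> N < h p'" for p'
    using that assms(1) assms(2)[of p'] by (meson leI not_le)
qed

lemma cut_point:
  assumes "h \<in> incr_seqs m l r"
  shows "cut_point m N h \<le> m"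
    and "s < cut_point m N h \<Longrightarrow> h s \<le> N"
    and "cut_point m N h \<le> s \<Longrightarrow> s < m \<Longrightarrow> N < h s"
proof -
  let ?p = "cut_point m N h"
  show "?p \<le> m" unfolding cut_point_def by (rule Least_le) simp
  show "h s \<le> N" if "s < ?p"
    using not_less_Least[of s "\<lambda>p. p = m \<or> N < h p"] that unfolding cut_point_def by auto
  have P: "?p = m \<or> N < h ?p" unfolding cut_point_def by (rule LeastI[of _ m]) simp
  show "N < h s" if "?p \<le> s" "s < m"
  proof (cases "s = ?p")
    case False
    then have "?p < s" using that(1) by simp
    then have "h ?p < h s" using assms that(2) unfolding incr_seqs_iff by blast
    then show ?thesis using P that by auto
  qed (use P that in auto)
qed

text \<open>
  The values of an increasing sequence that do not exceed \<open>N\<close> form an initial segment, so cutting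
  behind that segment and joining are inverse bijections.
\<close>

lemma sum_incr_seqs_split:
  assumes "l \<le> N" "N \<le> r"
  shows "sum F (incr_seqs m l r) =
    (\<Sum>p\<le>m. \<Sum>(f, g)\<in>incr_seqs p l N \<times> incr_seqs (m - p) N r. F (join_seq m p f g))"
proof -
  let ?S = "SIGMA p:{..m}. incr_seqs p l N \<times> incr_seqs (m - p) N r"
  let ?join = "\<lambda>(p, f, g). join_seq m p f g"
  let ?cut = "\<lambda>h. let p = cut_point m N h in
     (p, \<lambda>s. if s < p then h s else undefined, \<lambda>s. if s < m - p then h (s + p) else undefined)"
  have "sum F (incr_seqs m l r) = (\<Sum>x\<in>?S. F (?join x))"
  proof (rule sum.reindex_bij_witness[where i = ?join and j = ?cut])
    fix h assume h: "h \<in> incr_seqs m l r"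
    show "?join (?cut h) = h"
    proof
      fix s
      show "?join (?cut h) s = h s"
        using h cut_point(1)[OF h, of N] by (auto simp: join_seq_def Let_def incr_seqs_iff)
    qed
    then show "F (?join (?cut h)) = F h" by simp
    show "?cut h \<in> ?S"
      using cut_point(1)[OF h, of N] cut_point(2)[OF h, of _ N] cut_point(3)[OF h, of N] h
      by (auto simp: Let_def incr_seqs_iff)
  next
    fix x assume "x \<in> ?S"
    then obtain p f g where x: "x = (p, f, g)" and p: "p \<le> m"
      and f: "f \<in> incr_seqs p l N" and g: "g \<in> incr_seqs (m - p) N r" by auto
    show "?join x \<in> incr_seqs m l r"
      using join_seq_in_incr_seqs[OF assms p f g] by (simp add: x)
    have "cut_point m N (?join x) = p"
      using p incr_seqs_range[OF f] incr_seqs_range[OF g]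
      by (intro cut_point_eqI) (auto simp: x join_seq_def)
    then show "?cut (?join x) = x"
      using p f g by (auto simp: x Let_def join_seq_def incr_seqs_iff fun_eq_iff)
  qed
  also have "\<dots> = (\<Sum>p\<le>m. \<Sum>(f, g)\<in>incr_seqs p l N \<times> incr_seqs (m - p) N r. F (join_seq m p f g))"
    by (subst sum.Sigma) (auto simp: finite_incr_seqs case_prod_unfold)
  finally show ?thesis .
qed

lemma sum_incr_seqs_shift:
  "sum F (incr_seqs m (l + n) (r + n)) =
     (\<Sum>f\<in>incr_seqs m l r. F (\<lambda>s. if s < m then f s + n else undefined))"
proof (rule sum.reindex_bij_witness
    [where i = "\<lambda>f s. if s < m then f s + n else undefined"
       and j = "\<lambda>f s. if s < m then f s - n else undefined"])
  fix h assume h: "h \<in> incr_seqs m (l + n) (r + n)"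
  have ge: "n \<le> h s" if "s < m" for s using incr_seqs_range(1)[OF h that] by simp
  show inv: "(\<lambda>s. if s < m then (if s < m then h s - n else undefined) + n else undefined) = h"
    using h ge by (auto simp: incr_seqs_iff fun_eq_iff)
  show "(\<lambda>s. if s < m then h s - n else undefined) \<in> incr_seqs m l r"
    using h ge by (auto simp: incr_seqs_iff less_diff_conv intro!: diff_less_mono)
  show "F (\<lambda>s. if s < m then (if s < m then h s - n else undefined) + n else undefined) = F h"
    by (simp only: inv)
qed (auto simp: incr_seqs_iff fun_eq_iff)

section \<open>Compositions as matrices\<close>

definition weight :: "(nat \<times> nat \<Rightarrow> 'k::idom ^ 'd::finite) \<Rightarrow> 'd multiset mat \<Rightarrow>
    (nat \<Rightarrow> nat) \<Rightarrow> (nat \<Rightarrow> nat) \<Rightarrow> 'k" where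
  "weight Z M f g = (\<Prod>s<dim_row M. \<Prod>t<dim_col M. mon_eval (Z (f s, g t)) (M $$ (s, t)))"

definition SS_mat :: "nat \<times> nat \<Rightarrow> nat \<times> nat \<Rightarrow> (nat \<times> nat \<Rightarrow> 'k::idom ^ 'd::finite) \<Rightarrow>
    'd multiset mat \<Rightarrow> 'k" where
  "SS_mat l r Z M = (\<Sum>f\<in>incr_seqs (dim_row M) (fst l) (fst r).
     \<Sum>g\<in>incr_seqs (dim_col M) (snd l) (snd r). weight Z M f g)"

text \<open>
  \<open>reduced\<close> admits the \<open>0 \<times> 0\<close> matrix, which \<open>comp_of\<close> turns into the empty composition; thus
  \<open>comp_of\<close> is a bijection from the reduced matrices to \<open>Cmp\<close>.
\<close>

definition reduced :: "'d multiset mat \<Rightarrow> bool" where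
  "reduced M \<longleftrightarrow> (\<forall>s<dim_row M. \<exists>t<dim_col M. M $$ (s, t) \<noteq> {#}) \<and>
     (\<forall>t<dim_col M. \<exists>s<dim_row M. M $$ (s, t) \<noteq> {#})"

definition comp_of :: "'d multiset mat \<Rightarrow> 'd comp" where
  "comp_of M = (if dim_row M = 0 then EmptyComp else MatComp M)"

lemma reduced_dim_0: "reduced M \<Longrightarrow> dim_row M = 0 \<longleftrightarrow> dim_col M = 0"
  by (auto simp: reduced_def)

lemma Cmp_eq: "Cmp = comp_of ` {M. reduced M}"
proof (intro equalityI subsetI)
  fix a :: "'d comp" assume a: "a \<in> Cmp"
  show "a \<in> comp_of ` {M. reduced M}"
  proof (cases a)
    case EmptyComp
    then have "a = comp_of (mat 0 0 (\<lambda>_. {#}))" "reduced (mat 0 0 (\<lambda>_. {#}) :: 'd multiset mat)"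
      by (auto simp: comp_of_def reduced_def)
    then show ?thesis by blast
  next
    case (MatComp M)
    then have "a = comp_of M" "reduced M"
      using a by (auto simp: Cmp_def comp_of_def reduced_def)
    then show ?thesis by blast
  qed
next
  fix a :: "'d comp" assume "a \<in> comp_of ` {M. reduced M}"
  then obtain M where M: "a = comp_of M" "reduced M" by blast
  show "a \<in> Cmp"
  proof (cases "dim_row M = 0")
    case False
    then have "dim_row M \<ge> 1" "dim_col M \<ge> 1" using reduced_dim_0[OF M(2)] by auto
    then show ?thesis using M by (auto simp: Cmp_def comp_of_def reduced_def)
  qed (simp add: M(1) comp_of_def Cmp_def)
qed

lemma comp_of_inject:
  assumes "dim_row M = 0 \<longleftrightarrow> dim_col M = 0" "dim_row M' = 0 \<longleftrightarrow> dim_col M' = 0"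
  shows "comp_of M = comp_of M' \<longleftrightarrow> M = M'"
  using assms by (auto simp: comp_of_def split: if_splits)

text \<open>
  For the \<open>0 \<times> 0\<close> matrix there is one pair of (empty) sequences, and its weight is an empty product,
  which gives the value 1 prescribed for the empty composition.
\<close>

lemma SS_between_comp_of:
  assumes "reduced M"
  shows "SS_between l r Z (comp_of M) = SS_mat l r Z M"
proof (cases "dim_row M = 0")
  case True
  then have "dim_col M = 0" using reduced_dim_0[OF assms] by simp
  moreover have "incr_seqs 0 p q = {\<lambda>_. undefined}" for p q
    by (auto simp: incr_seqs_iff)
  ultimately show ?thesis using True by (simp add: comp_of_def SS_mat_def weight_def)
next
  case False
  then show ?thesis
    by (simp add: comp_of_def SS_mat_def weight_def sum.cartesian_product)
qed

section \<open>Block diagonal cuts and factorizations\<close>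

definition block_diag :: "'d multiset mat \<Rightarrow> 'd multiset mat \<Rightarrow> 'd multiset mat" where
  "block_diag U L = four_block_mat U (mat (dim_row U) (dim_col L) (\<lambda>_. {#}))
     (mat (dim_row L) (dim_col U) (\<lambda>_. {#})) L"

lemma diag_comp_of:
  assumes "reduced U" "reduced L"
  shows "diag (comp_of U) (comp_of L) = comp_of (block_diag U L)"
proof -
  have "block_diag U L = L" if "dim_row U = 0"
    using that reduced_dim_0[OF assms(1)] by (intro eq_matI) (auto simp: block_diag_def)
  moreover have "block_diag U L = U" if "dim_row L = 0"
    using that reduced_dim_0[OF assms(2)] by (intro eq_matI) (auto simp: block_diag_def)
  ultimately show ?thesis
    by (auto simp: comp_of_def block_diag_def)
qed

definition splits_at :: "'d multiset mat \<Rightarrow> nat \<Rightarrow> nat \<Rightarrow> bool" where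
  "splits_at M p q \<longleftrightarrow>
     (\<forall>s<dim_row M. \<forall>t<dim_col M. (s < p) \<noteq> (t < q) \<longrightarrow> M $$ (s, t) = {#})"

definition upper_block :: "'d multiset mat \<Rightarrow> nat \<Rightarrow> nat \<Rightarrow> 'd multiset mat" where
  "upper_block M p q = mat p q (\<lambda>(s, t). M $$ (s, t))"

definition lower_block :: "'d multiset mat \<Rightarrow> nat \<Rightarrow> nat \<Rightarrow> 'd multiset mat" where
  "lower_block M p q = mat (dim_row M - p) (dim_col M - q) (\<lambda>(s, t). M $$ (s + p, t + q))"

lemma dim_blocks [simp]:
  "dim_row (upper_block M p q) = p" "dim_col (upper_block M p q) = q"
  "dim_row (lower_block M p q) = dim_row M - p" "dim_col (lower_block M p q) = dim_col M - q"
  by (auto simp: upper_block_def lower_block_def)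

lemma block_diag_blocks:
  assumes "p \<le> dim_row M" "q \<le> dim_col M" "splits_at M p q"
  shows "block_diag (upper_block M p q) (lower_block M p q) = M"
  using assms
  by (intro eq_matI) (auto simp: block_diag_def upper_block_def lower_block_def splits_at_def)

lemma blocks_block_diag:
  "upper_block (block_diag U L) (dim_row U) (dim_col U) = U"
  "lower_block (block_diag U L) (dim_row U) (dim_col U) = L"
  by (auto intro!: eq_matI simp: block_diag_def upper_block_def lower_block_def)

lemma splits_at_block_diag: "splits_at (block_diag U L) (dim_row U) (dim_col U)"
  by (auto simp: splits_at_def block_diag_def)

text \<open>
  A letter in a row of a block occurs in \<open>M\<close> within the columns of the same block, since everything
  beside the block is \<open>\<epsilon>\<close>; the same holds for columns.  If \<open>p = 0\<close>, this forces \<open>q = 0\<close>, so a block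
  with one dimension 0 is the \<open>0 \<times> 0\<close> matrix.
\<close>

lemma reduced_blocks:
  assumes "reduced M" "p \<le> dim_row M" "q \<le> dim_col M" "splits_at M p q"
  shows "reduced (upper_block M p q)" "reduced (lower_block M p q)"
proof -
  have same: "s < p \<longleftrightarrow> t < q" if "s < dim_row M" "t < dim_col M" "M $$ (s, t) \<noteq> {#}" for s t
    using assms(4) that unfolding splits_at_def by blast
  have row: "\<exists>t<dim_col M. M $$ (s, t) \<noteq> {#} \<and> (s < p \<longleftrightarrow> t < q)" if "s < dim_row M" for s
    using assms(1) same that unfolding reduced_def by blast
  have col: "\<exists>s<dim_row M. M $$ (s, t) \<noteq> {#} \<and> (s < p \<longleftrightarrow> t < q)" if "t < dim_col M" for t
    using assms(1) same that unfolding reduced_def by blast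
  show "reduced (upper_block M p q)"
    unfolding reduced_def dim_blocks
  proof (intro conjI allI impI)
    fix s assume "s < p"
    then show "\<exists>t<q. upper_block M p q $$ (s, t) \<noteq> {#}"
      using row[of s] assms(2) by (auto simp: upper_block_def)
  next
    fix t assume "t < q"
    then show "\<exists>s<p. upper_block M p q $$ (s, t) \<noteq> {#}"
      using col[of t] assms(3) by (auto simp: upper_block_def)
  qed
  show "reduced (lower_block M p q)"
    unfolding reduced_def dim_blocks
  proof (intro conjI allI impI)
    fix s assume s: "s < dim_row M - p"
    then obtain t where "t < dim_col M" "M $$ (s + p, t) \<noteq> {#}" "q \<le> t"
      using row[of "s + p"] by (auto simp: not_less less_diff_conv)
    then show "\<exists>t<dim_col M - q. lower_block M p q $$ (s, t) \<noteq> {#}"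
      using s by (intro exI[of _ "t - q"]) (auto simp: lower_block_def)
  next
    fix t assume t: "t < dim_col M - q"
    then obtain s where "s < dim_row M" "M $$ (s, t + q) \<noteq> {#}" "p \<le> s"
      using col[of "t + q"] by (auto simp: not_less less_diff_conv)
    then show "\<exists>s<dim_row M - p. lower_block M p q $$ (s, t) \<noteq> {#}"
      using t by (intro exI[of _ "s - p"]) (auto simp: lower_block_def)
  qed
qed

text \<open>
  A cut is recovered from its blocks as the size of the upper one, and a factorization
  \<open>diag b c = a\<close> arises from the cut given by the size of \<open>b\<close>.
\<close>

lemma sum_diag_factorizations:
  assumes "reduced M"
  shows "(\<Sum>(b, c) \<in> {(b, c) \<in> Cmp \<times> Cmp. diag b c = comp_of M}. G b c) =
    (\<Sum>(p, q) \<in> {(p, q) \<in> {..dim_row M} \<times> {..dim_col M}. splits_at M p q}.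
       G (comp_of (upper_block M p q)) (comp_of (lower_block M p q)))"
proof -
  let ?D = "{(b, c) \<in> Cmp \<times> Cmp. diag b c = comp_of M}"
  let ?S = "{(p, q) \<in> {..dim_row M} \<times> {..dim_col M}. splits_at M p q}"
  let ?blocks = "\<lambda>(p, q). (comp_of (upper_block M p q), comp_of (lower_block M p q))"
  have "bij_betw ?blocks ?S ?D"
  proof (rule bij_betwI')
    fix x y assume x: "x \<in> ?S" and y: "y \<in> ?S"
    show "(?blocks x = ?blocks y) = (x = y)"
    proof
      assume eq: "?blocks x = ?blocks y"
      obtain p q p' q' where xy: "x = (p, q)" "y = (p', q')" by (cases x, cases y) blast
      have "upper_block M p q = upper_block M p' q'"
        using eq x y comp_of_inject[OF reduced_dim_0 reduced_dim_0] reduced_blocks(1)[OF assms]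
        by (auto simp: xy)
      from arg_cong[OF this, of dim_row] arg_cong[OF this, of dim_col] show "x = y"
        by (simp add: xy)
    qed simp
  next
    fix x assume "x \<in> ?S"
    then show "?blocks x \<in> ?D"
      using reduced_blocks[OF assms] block_diag_blocks[of _ M] by (auto simp: Cmp_eq diag_comp_of)
  next
    fix y assume "y \<in> ?D"
    then obtain U L where UL: "y = (comp_of U, comp_of L)" "reduced U" "reduced L"
      and eq: "comp_of (block_diag U L) = comp_of M"
      by (auto simp: Cmp_eq diag_comp_of)
    have "dim_row (block_diag U L) = 0 \<longleftrightarrow> dim_col (block_diag U L) = 0"
      using reduced_dim_0[OF UL(2)] reduced_dim_0[OF UL(3)] by (simp add: block_diag_def)
    then have M: "M = block_diag U L"
      using eq comp_of_inject[OF _ reduced_dim_0[OF assms]] by simp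
    have "(dim_row U, dim_col U) \<in> ?S"
      using splits_at_block_diag[of U L] by (auto simp: M) (auto simp: block_diag_def)
    moreover have "y = ?blocks (dim_row U, dim_col U)"
      by (simp add: UL M blocks_block_diag)
    ultimately show "\<exists>x\<in>?S. y = ?blocks x" by blast
  qed
  then have "(\<Sum>x\<in>?S. case ?blocks x of (b, c) \<Rightarrow> G b c) = (\<Sum>(b, c)\<in>?D. G b c)"
    by (rule sum.reindex_bij_betw)
  then show ?thesis by (simp add: case_prod_unfold)
qed

section \<open>The factorization of bounded sums\<close>

lemma prod_lessThan_split:
  fixes h :: "nat \<Rightarrow> 'a::comm_monoid_mult"
  assumes "p \<le> m"
  shows "prod h {..<m} = prod h {..<p} * (\<Prod>s<m - p. h (s + p))"
proof -
  have "prod h {..<p + k} = prod h {..<p} * (\<Prod>s<k. h (s + p))" for k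
    by (induction k) (simp_all add: ac_simps)
  from this[of "m - p"] assms show ?thesis by simp
qed

text \<open>
  If \<open>M\<close> has a letter off the two blocks, then \<open>Z\<close> vanishes at the position assigned to it, and so
  does the weight.  Otherwise the entries off the blocks are \<open>\<epsilon>\<close> and contribute the factor 1.
\<close>

lemma weight_join_seq:
  assumes p: "p \<le> dim_row M" and q: "q \<le> dim_col M"
    and f: "f \<in> incr_seqs p (fst l) (fst N)" "f' \<in> incr_seqs (dim_row M - p) (fst N) (fst r)"
    and g: "g \<in> incr_seqs q (snd l) (snd N)" "g' \<in> incr_seqs (dim_col M - q) (snd N) (snd r)"
    and Z: "\<And>i. (fst i \<le> fst N) \<noteq> (snd i \<le> snd N) \<Longrightarrow> Z i = 0"
  shows "weight Z M (join_seq (dim_row M) p f f') (join_seq (dim_col M) q g g') =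
    (if splits_at M p q
     then weight Z (upper_block M p q) f g * weight Z (lower_block M p q) f' g' else 0)"
proof -
  let ?h = "join_seq (dim_row M) p f f'" and ?k = "join_seq (dim_col M) q g g'"
  let ?e = "\<lambda>s t. mon_eval (Z (?h s, ?k t)) (M $$ (s, t))"
  have h: "?h s \<le> fst N \<longleftrightarrow> s < p" if "s < dim_row M" for s
    using that incr_seqs_range[OF f(1), of s] incr_seqs_range[OF f(2), of "s - p"]
      diff_less_mono[OF that, of p] by (auto simp: join_seq_def not_less)
  have k: "?k t \<le> snd N \<longleftrightarrow> t < q" if "t < dim_col M" for t
    using that incr_seqs_range[OF g(1), of t] incr_seqs_range[OF g(2), of "t - q"]
      diff_less_mono[OF that, of q] by (auto simp: join_seq_def not_less)
  have zero: "Z (?h s, ?k t) = 0"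
    if "s < dim_row M" "t < dim_col M" "(s < p) \<noteq> (t < q)" for s t
    using that h k by (intro Z) simp
  show ?thesis
  proof (cases "splits_at M p q")
    case False
    then obtain s t where st: "s < dim_row M" "t < dim_col M" "(s < p) \<noteq> (t < q)"
      "M $$ (s, t) \<noteq> {#}" by (auto simp: splits_at_def)
    then have "?e s t = 0" using zero mon_eval_zero by simp
    then have "(\<Prod>t<dim_col M. ?e s t) = 0" using st(2) by (intro prod_zero) auto
    then have "weight Z M ?h ?k = 0"
      unfolding weight_def using st(1) by (intro prod_zero) auto
    then show ?thesis using False by simp
  next
    case True
    have one: "?e s t = 1" if "s < dim_row M" "t < dim_col M" "(s < p) \<noteq> (t < q)" for s t
      using True that by (auto simp: splits_at_def mon_eval_hom)
    have up: "(\<Prod>t<dim_col M. ?e s t) =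
        (\<Prod>t<q. mon_eval (Z (f s, g t)) (upper_block M p q $$ (s, t)))" if s: "s < p" for s
    proof -
      have "(\<Prod>t<dim_col M - q. ?e s (t + q)) = 1"
        using s p by (intro prod.neutral) (auto intro!: one)
      moreover have "(\<Prod>t<q. ?e s t) =
          (\<Prod>t<q. mon_eval (Z (f s, g t)) (upper_block M p q $$ (s, t)))"
        using s by (intro prod.cong) (auto simp: join_seq_def upper_block_def)
      ultimately show ?thesis by (simp add: prod_lessThan_split[OF q])
    qed
    have lo: "(\<Prod>t<dim_col M. ?e (s + p) t) =
        (\<Prod>t<dim_col M - q. mon_eval (Z (f' s, g' t)) (lower_block M p q $$ (s, t)))"
      if s: "s < dim_row M - p" for s
    proof -
      have "(\<Prod>t<q. ?e (s + p) t) = 1"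
        using s q by (intro prod.neutral) (auto intro!: one)
      moreover have "(\<Prod>t<dim_col M - q. ?e (s + p) (t + q)) =
          (\<Prod>t<dim_col M - q. mon_eval (Z (f' s, g' t)) (lower_block M p q $$ (s, t)))"
        using s by (intro prod.cong) (auto simp: join_seq_def lower_block_def)
      ultimately show ?thesis by (simp add: prod_lessThan_split[OF q])
    qed
    show ?thesis
      using True up lo by (simp add: weight_def prod_lessThan_split[OF p])
  qed
qed

lemma SS_mat_split:
  assumes "l \<le> N" "N \<le> r"
    and Z: "\<And>i. (fst i \<le> fst N) \<noteq> (snd i \<le> snd N) \<Longrightarrow> Z i = 0"
  shows "SS_mat l r Z M =
    (\<Sum>(p, q) \<in> {(p, q) \<in> {..dim_row M} \<times> {..dim_col M}. splits_at M p q}.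
       SS_mat l N Z (upper_block M p q) * SS_mat N r Z (lower_block M p q))"
proof -
  let ?m = "dim_row M" and ?n = "dim_col M"
  let ?R = "\<lambda>p. incr_seqs p (fst l) (fst N)" and ?R' = "\<lambda>p. incr_seqs (?m - p) (fst N) (fst r)"
  let ?C = "\<lambda>q. incr_seqs q (snd l) (snd N)" and ?C' = "\<lambda>q. incr_seqs (?n - q) (snd N) (snd r)"
  let ?U = "\<lambda>p q. SS_mat l N Z (upper_block M p q)"
  let ?L = "\<lambda>p q. SS_mat N r Z (lower_block M p q)"
  have block: "(\<Sum>(f, f')\<in>?R p \<times> ?R' p. \<Sum>(g, g')\<in>?C q \<times> ?C' q.
        weight Z M (join_seq ?m p f f') (join_seq ?n q g g')) =
      (if splits_at M p q then ?U p q * ?L p q else 0)" if pq: "p \<le> ?m" "q \<le> ?n" for p q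
  proof -
    let ?w = "\<lambda>f g. weight Z (upper_block M p q) f g" and ?w' = "\<lambda>f g. weight Z (lower_block M p q) f g"
    have "(\<Sum>(f, f')\<in>?R p \<times> ?R' p. \<Sum>(g, g')\<in>?C q \<times> ?C' q.
        weight Z M (join_seq ?m p f f') (join_seq ?n q g g')) =
      (\<Sum>(f, f')\<in>?R p \<times> ?R' p. \<Sum>(g, g')\<in>?C q \<times> ?C' q.
        if splits_at M p q then ?w f g * ?w' f' g' else 0)"
      by (intro sum.cong refl) (auto intro!: sum.cong weight_join_seq[OF pq] Z)
    also have "\<dots> = (if splits_at M p q then ?U p q * ?L p q else 0)"
      by (simp add: SS_mat_def sum_product sum.cartesian_product[symmetric])
    finally show ?thesis .
  qed
  have "SS_mat l r Z M = (\<Sum>p\<le>?m. \<Sum>(f, f')\<in>?R p \<times> ?R' p. \<Sum>q\<le>?n. \<Sum>(g, g')\<in>?C q \<times> ?C' q.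
      weight Z M (join_seq ?m p f f') (join_seq ?n q g g'))"
    using assms(1,2) by (simp add: SS_mat_def less_eq_prod_def sum_incr_seqs_split[of _ "fst N"]
        sum_incr_seqs_split[of _ "snd N"])
  also have "\<dots> = (\<Sum>p\<le>?m. \<Sum>q\<le>?n. \<Sum>(f, f')\<in>?R p \<times> ?R' p. \<Sum>(g, g')\<in>?C q \<times> ?C' q.
      weight Z M (join_seq ?m p f f') (join_seq ?n q g g'))"
    unfolding case_prod_unfold by (subst sum.swap) (rule refl)
  also have "\<dots> = (\<Sum>p\<le>?m. \<Sum>q\<le>?n. if splits_at M p q then ?U p q * ?L p q else 0)"
    by (intro sum.cong refl block) auto
  also have "\<dots> = (\<Sum>x\<in>{..?m} \<times> {..?n}. if (case x of (p, q) \<Rightarrow> splits_at M p q)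
      then (case x of (p, q) \<Rightarrow> ?U p q * ?L p q) else 0)"
    by (simp only: sum.cartesian_product case_prod_unfold)
  also have "\<dots> = (\<Sum>x\<in>{x \<in> {..?m} \<times> {..?n}. case x of (p, q) \<Rightarrow> splits_at M p q}.
      case x of (p, q) \<Rightarrow> ?U p q * ?L p q)"
    by (rule sum.inter_filter[symmetric]) simp
  finally show ?thesis by (simp only: case_prod_unfold prod.collapse)
qed

lemma SS_between_split:
  assumes "l \<le> N" "N \<le> r"
    and "\<And>i. (fst i \<le> fst N) \<noteq> (snd i \<le> snd N) \<Longrightarrow> Z i = 0"
    and a: "a \<in> Cmp"
  shows "SS_between l r Z a = (\<Sum>(b, c) \<in> {(b, c) \<in> Cmp \<times> Cmp. diag b c = a}.
    SS_between l N Z b * SS_between N r Z c)"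
proof -
  obtain M where M: "a = comp_of M" "reduced M" using a by (auto simp: Cmp_eq)
  have "SS_between l r Z a = SS_mat l r Z M"
    by (simp only: M SS_between_comp_of)
  also have "\<dots> = (\<Sum>(p, q) \<in> {(p, q) \<in> {..dim_row M} \<times> {..dim_col M}. splits_at M p q}.
      SS_mat l N Z (upper_block M p q) * SS_mat N r Z (lower_block M p q))"
    by (rule SS_mat_split[OF assms(1-3)])
  also have "\<dots> = (\<Sum>(p, q) \<in> {(p, q) \<in> {..dim_row M} \<times> {..dim_col M}. splits_at M p q}.
      SS_between l N Z (comp_of (upper_block M p q)) * SS_between N r Z (comp_of (lower_block M p q)))"
    by (intro sum.cong refl) (auto simp: SS_between_comp_of reduced_blocks[OF M(2)])
  also have "\<dots> = (\<Sum>(b, c) \<in> {(b, c) \<in> Cmp \<times> Cmp. diag b c = a}.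
      SS_between l N Z b * SS_between N r Z c)"
    by (simp only: M(1) sum_diag_factorizations[OF M(2)])
  finally show ?thesis .
qed

section \<open>The sums of a diagonal concatenation\<close>

lemma SS_between_cong:
  assumes "\<And>i j. fst l < i \<Longrightarrow> i \<le> fst r \<Longrightarrow> snd l < j \<Longrightarrow> j \<le> snd r \<Longrightarrow> Z (i, j) = Z' (i, j)"
  shows "SS_between l r Z a = SS_between l r Z' a"
proof (cases a)
  case (MatComp M)
  then show ?thesis
    by (auto intro!: sum.cong prod.cong simp: assms incr_seqs_range)
qed simp

lemma SS_between_shift:
  "SS_between (l + N) (r + N) Z a = SS_between l r (\<lambda>i. Z (i + N)) a"
proof (cases a)
  case (MatComp M)
  then show ?thesis
    by (simp add: sum.cartesian_product[symmetric] sum_incr_seqs_shift plus_prod_def)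
qed simp

text \<open>
  Index 0 lies below every insertion position, so insertion leaves it alone instead of shifting it.
\<close>

lemma Zero_ins_rows_iter:
  "(Zero_ins 1 1 ^^ n) X i =
     (if fst i = 0 then X i else if fst i \<le> n then 0 else X (fst i - n, snd i))"
proof (induction n arbitrary: i)
  case (Suc n)
  then show ?case by (cases i) (auto simp: Zero_ins_def coord_def unit_index_def)
qed auto

lemma Zero_ins_cols_iter:
  "(Zero_ins 2 1 ^^ n) X i =
     (if snd i = 0 then X i else if snd i \<le> n then 0 else X (fst i, snd i - n))"
proof (induction n arbitrary: i)
  case (Suc n)
  then show ?case by (cases i) (auto simp: Zero_ins_def coord_def unit_index_def)
qed auto

lemma diag_concat_eq:
  assumes "B \<in> evZ"
  shows "(A \<oslash> B) i = A i + (if fst i \<le> rows_ev A \<or> snd i \<le> cols_ev A then 0 else B (i - size_ev A))"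
proof -
  \<comment> \<open>The unshifted values at index 0 are zero for members of \<open>evZ\<close>.\<close>
  have "B (x, y) = 0" if "x = 0 \<or> y = 0" for x y
    using assms that by (force simp: evZ_def less_eq_prod_def)
  then show ?thesis
    unfolding diag_concat_def Zero_ins_rows_iter Zero_ins_cols_iter
    by (cases i) (auto simp: minus_prod_def)
qed

lemma diag_concat_off_blocks:
  assumes "A \<in> evZ" "B \<in> evZ" "(fst i \<le> rows_ev A) \<noteq> (snd i \<le> cols_ev A)"
  shows "(A \<oslash> B) i = 0"
proof -
  have "A i = 0" using size_ev(2)[OF assms(1), of i] assms(3) by (auto simp: less_eq_prod_def)
  then show ?thesis using assms by (auto simp: diag_concat_eq)
qed

lemma SS_eq_SS_between:
  assumes "Z \<in> evZ" "a \<in> Cmp" "size_ev Z \<le> r"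
  shows "SS Z a = SS_between (0, 0) r Z a"
  using SS_between_stable[OF assms(1,2)] assms(3) by (intro SS_eqI[of r]) (metis order_trans)

lemma SS_between_diag_concat_upper:
  assumes "A \<in> evZ" "B \<in> evZ" "a \<in> Cmp"
  shows "SS_between (0, 0) (size_ev A) (A \<oslash> B) a = SS A a"
proof -
  have "SS_between (0, 0) (size_ev A) (A \<oslash> B) a = SS_between (0, 0) (size_ev A) A a"
    by (rule SS_between_cong) (simp add: diag_concat_eq[OF assms(2)])
  then show ?thesis using SS_eq_SS_between[OF assms(1,3) order_refl] by simp
qed

lemma SS_between_diag_concat_lower:
  assumes A: "A \<in> evZ" and B: "B \<in> evZ" and a: "a \<in> Cmp" and r: "size_ev B + size_ev A \<le> r"
  shows "SS_between (size_ev A) r (A \<oslash> B) a = SS B a"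
proof -
  obtain r' where r': "r = r' + size_ev A" "size_ev B \<le> r'"
  proof
    show "r = (r - size_ev A) + size_ev A" "size_ev B \<le> r - size_ev A"
      using r by (auto simp: less_eq_prod_def plus_prod_def minus_prod_def prod_eq_iff)
  qed
  have "SS_between (size_ev A) r (A \<oslash> B) a =
      SS_between (0, 0) r' (\<lambda>i. (A \<oslash> B) (i + size_ev A)) a"
    using SS_between_shift[of "(0, 0)" "size_ev A" r' "A \<oslash> B" a] by (simp add: r'(1) plus_prod_def)
  also have "\<dots> = SS_between (0, 0) r' B a"
  proof (rule SS_between_cong)
    fix i j :: nat assume "fst (0, 0) < i" "snd (0, 0) < j"
    then show "(A \<oslash> B) ((i, j) + size_ev A) = B (i, j)"
      using size_ev(2)[OF A, of "(i, j) + size_ev A"]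
      by (auto simp: diag_concat_eq[OF B] less_eq_prod_def minus_prod_def plus_prod_def)
  qed
  also have "\<dots> = SS B a" using SS_eq_SS_between[OF B a r'(2)] by simp
  finally show ?thesis .
qed

theorem lemma2p34:
  shows "(\<forall>(A :: nat \<times> nat \<Rightarrow> 'k::idom ^ 'd::finite) \<in> evZ. \<forall>B \<in> evZ. \<forall>l r :: nat \<times> nat.
            l \<le> size_ev A \<longrightarrow> size_ev A \<le> r \<longrightarrow>
            (\<forall>a \<in> Cmp. SS_between l r (A \<oslash> B) a =
               (\<Sum>(b, c) \<in> {(b, c) \<in> Cmp \<times> Cmp. diag b c = a}.
                  SS_between l (size_ev A) (A \<oslash> B) b * SS_between (size_ev A) r (A \<oslash> B) c)))
         \<and> (\<forall>(A :: nat \<times> nat \<Rightarrow> 'k ^ 'd) \<in> evZ. \<forall>B \<in> evZ.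
            \<forall>a \<in> Cmp. SS (A \<oslash> B) a = comp_mult (SS A) (SS B) a)"
proof (intro conjI ballI allI impI)
  fix A B :: "nat \<times> nat \<Rightarrow> 'k ^ 'd" and l r :: "nat \<times> nat" and a :: "'d comp"
  assume "A \<in> evZ" "B \<in> evZ" "l \<le> size_ev A" "size_ev A \<le> r" "a \<in> Cmp"
  then show "SS_between l r (A \<oslash> B) a = (\<Sum>(b, c) \<in> {(b, c) \<in> Cmp \<times> Cmp. diag b c = a}.
      SS_between l (size_ev A) (A \<oslash> B) b * SS_between (size_ev A) r (A \<oslash> B) c)"
    by (intro SS_between_split diag_concat_off_blocks)
next
  fix A B :: "nat \<times> nat \<Rightarrow> 'k ^ 'd" and a :: "'d comp"
  assume A: "A \<in> evZ" and B: "B \<in> evZ" and a: "a \<in> Cmp"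
  show "SS (A \<oslash> B) a = comp_mult (SS A) (SS B) a"
  proof (rule SS_eqI)
    fix r assume r: "size_ev B + size_ev A \<le> r"
    then have "size_ev A \<le> r" by (auto simp: less_eq_prod_def plus_prod_def)
    then have "SS_between (0, 0) r (A \<oslash> B) a = (\<Sum>(b, c) \<in> {(b, c) \<in> Cmp \<times> Cmp. diag b c = a}.
        SS_between (0, 0) (size_ev A) (A \<oslash> B) b * SS_between (size_ev A) r (A \<oslash> B) c)"
      using A B a by (intro SS_between_split diag_concat_off_blocks) (auto simp: less_eq_prod_def)
    also have "\<dots> = comp_mult (SS A) (SS B) a"
      unfolding comp_mult_def
      by (intro sum.cong refl)
        (auto simp: SS_between_diag_concat_upper[OF A B] SS_between_diag_concat_lower[OF A B _ r])
    finally show "SS_between (0, 0) r (A \<oslash> B) a = comp_mult (SS A) (SS B) a" .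
  qed
qed

end
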